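(* For every $t\in\mathbb{C}\setminus\{0\}$ and every integer $m\ge 0$, $$\left.\frac{\partial^{2}Y_{\nu}(t)}{\partial\nu^{2}}\right|_{\nu=m}+(-1)^{m+1}\left.\frac{\partial^{2}Y_{\nu}(t)}{\partial\nu^{2}}\right|_{\nu=-m}=-2\pi\left.\frac{\partial J_{\nu}(t)}{\partial\nu}\right|_{\nu=m}+\pi^{2}Y_{m}(t).$$
   Context: $J_\nu(t)=\sum_{k=0}^{\infty}\frac{(-1)^k}{k!\,\Gamma(k+\nu+1)}\left(\frac{t}{2}\right)^{2k+\nu}$ is the Bessel function of the first kind (principal branch, $-\pi<\arg t\le\pi$; $1/\Gamma$ is zero at the poles of $\Gamma$), and $Y_\nu(t)=\frac{J_\nu(t)\cos\pi\nu-J_{-\nu}(t)}{\sin\pi\nu}$ (for integer $\nu$, the limit in $\nu$) is the Bessel function of the second kind. *)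

theory Defs
  imports "HOL-Analysis.Analysis"
begin

text \<open>
  \<^const>\<open>rGamma\<close> is the entire function 1/Gamma (zero at the poles of Gamma), and complex
  \<^const>\<open>powr\<close> is defined through \<^const>\<open>Ln\<close>, the branch of the logarithm whose imaginary
  part lies in (-pi, pi].
\<close>

definition Bessel_J :: "complex \<Rightarrow> complex \<Rightarrow> complex" where
  "Bessel_J \<nu> t =
     (\<Sum>k. (-1) ^ k * rGamma (of_nat k + \<nu> + 1) / fact k * (t / 2) powr (2 * of_nat k + \<nu>))"

definition Bessel_Y :: "complex \<Rightarrow> complex \<Rightarrow> complex" where
  "Bessel_Y \<nu> t =
     (let q = (\<lambda>\<mu>. (Bessel_J \<mu> t * cos (of_real pi * \<mu>) - Bessel_J (- \<mu>) t) / sin (of_real pi * \<mu>))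
      in if \<nu> \<in> \<int> then Lim (at \<nu>) q else q \<nu>)"

end

theory Submission
  imports Defs "HOL-Complex_Analysis.Complex_Analysis"
begin

text \<open>
  For \<open>t \<noteq> 0\<close> both \<open>J\<^sub>\<nu>(t)\<close> and \<open>Y\<^sub>\<nu>(t)\<close> are entire in \<open>\<nu>\<close>: the series of \<open>J\<^sub>\<nu>(t)\<close> converges locally
  uniformly, and the numerator of the quotient defining \<open>Y\<^sub>\<nu>(t)\<close> vanishes at the integers, which are
  therefore removable singularities. Eliminating \<open>J\<^sub>-\<^sub>\<nu>\<close> from the definitions of \<open>Y\<^sub>\<nu>\<close> and \<open>Y\<^sub>-\<^sub>\<nu>\<close> gives
  the reflection formula \<open>Y\<^sub>-\<^sub>\<nu> = J\<^sub>\<nu> sin \<pi>\<nu> + Y\<^sub>\<nu> cos \<pi>\<nu>\<close> off the integers, hence everywhere by continuity.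
  The theorem is its second derivative at \<open>\<nu> = m\<close>.
\<close>

section \<open>Local uniform convergence of the series of J and its holomorphy in the order\<close>

text \<open>For \<open>k \<ge> R\<close> the factor in \<open>rGamma (k + \<nu> + 1) = (k + \<nu> + 1) * rGamma (k + \<nu> + 2)\<close> has modulus at
  least 1, so the moduli decrease in \<open>k\<close>.\<close>

lemma rGamma_shift_bounded_on_cball:
  fixes R :: real
  obtains M where "M \<ge> 0"
    "\<And>(\<nu>::complex) k. \<nu> \<in> cball 0 R \<Longrightarrow> nat \<lceil>R\<rceil> \<le> k \<Longrightarrow> norm (rGamma (of_nat k + \<nu> + 1)) \<le> M"
proof -
  define N where "N = nat \<lceil>R\<rceil>"
  have N: "real N \<ge> R"
    unfolding N_def by linarith
  have "compact ((\<lambda>\<nu>::complex. rGamma (of_nat N + \<nu> + 1)) ` cball 0 R)"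
    by (intro compact_continuous_image holomorphic_on_imp_continuous_on holomorphic_intros) auto
  from compact_imp_bounded[OF this] obtain M where M: "M > 0"
    "\<And>\<nu>::complex. \<nu> \<in> cball 0 R \<Longrightarrow> norm (rGamma (of_nat N + \<nu> + 1)) \<le> M"
    unfolding bounded_pos by blast
  have "norm (rGamma (of_nat k + \<nu> + 1)) \<le> M" if "\<nu> \<in> cball 0 R" "N \<le> k" for \<nu> :: complex and k
    using that(2)
  proof (induction k rule: dec_induct)
    case base
    then show ?case using M that by simp
  next
    case (step k)
    have "norm (of_nat (Suc k) :: complex) \<le> norm (of_nat k + \<nu> + 1) + norm \<nu>"
      using norm_triangle_ineq4[of "of_nat k + \<nu> + 1" \<nu>] by (simp add: add_ac)
    then have "1 \<le> norm (of_nat k + \<nu> + 1)"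
      using that(1) N step.hyps unfolding norm_of_nat by simp
    then have "norm (rGamma (of_nat (Suc k) + \<nu> + 1))
        \<le> norm (of_nat k + \<nu> + 1) * norm (rGamma (of_nat (Suc k) + \<nu> + 1))"
      using mult_right_mono[of 1 "norm (of_nat k + \<nu> + 1)" "norm (rGamma (of_nat (Suc k) + \<nu> + 1))"]
      by simp
    also have "\<dots> = norm (rGamma (of_nat k + \<nu> + 1))"
      unfolding norm_mult[symmetric] using rGamma_plus1[of "of_nat k + \<nu> + 1"]
      by (simp add: add_ac)
    finally show ?case using step.IH by simp
  qed
  then show thesis
    using that[of M] M(1) unfolding N_def by auto
qed

text \<open>The order comes last so that partial application leaves a function of the order.\<close>

definition Bessel_J_term :: "complex \<Rightarrow> nat \<Rightarrow> complex \<Rightarrow> complex" where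
  "Bessel_J_term t k \<nu> =
     (-1) ^ k * rGamma (of_nat k + \<nu> + 1) / fact k * (t / 2) powr (2 * of_nat k + \<nu>)"

lemma Bessel_J_eq_suminf: "Bessel_J \<nu> t = (\<Sum>k. Bessel_J_term t k \<nu>)"
  by (simp add: Bessel_J_def Bessel_J_term_def)

lemma Bessel_J_term_holomorphic: "t \<noteq> 0 \<Longrightarrow> Bessel_J_term t k holomorphic_on A"
  unfolding Bessel_J_term_def powr_def by (auto intro!: holomorphic_intros)

text \<open>Splitting off \<open>(t / 2) powr \<nu>\<close> leaves the even power
  \<open>(t / 2) ^ (2 * k)\<close>. On the disc this factor and the \<open>rGamma\<close> factor
  have bounds independent of k, so a multiple of the exponential series of |t/2|^2 majorises the
  tail, uniformly in \<nu>.\<close>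

lemma Bessel_J_term_dominated:
  assumes "t \<noteq> 0"
  obtains h :: "nat \<Rightarrow> real" where "summable h"
    "\<And>k \<nu>. nat \<lceil>R\<rceil> \<le> k \<Longrightarrow> \<nu> \<in> cball 0 R \<Longrightarrow> norm (Bessel_J_term t k \<nu>) \<le> h k"
proof -
  obtain M where M: "M \<ge> 0"
    "\<And>(\<nu>::complex) k. \<nu> \<in> cball 0 R \<Longrightarrow> nat \<lceil>R\<rceil> \<le> k \<Longrightarrow> norm (rGamma (of_nat k + \<nu> + 1)) \<le> M"
    using rGamma_shift_bounded_on_cball by blast
  have "compact ((\<lambda>\<nu>. (t / 2) powr \<nu>) ` cball 0 R)"
    using assms unfolding powr_def by (auto intro!: compact_continuous_image continuous_intros)
  from compact_imp_bounded[OF this] obtain C where C: "C > 0"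
    "\<And>\<nu>. \<nu> \<in> cball 0 R \<Longrightarrow> norm ((t / 2) powr \<nu>) \<le> C"
    unfolding bounded_pos by blast
  define h where "h k = M * C * (inverse (fact k) * (norm (t / 2) ^ 2) ^ k)" for k
  have "summable h"
    unfolding h_def by (intro summable_mult summable_exp)
  moreover have "norm (Bessel_J_term t k \<nu>) \<le> h k" if "nat \<lceil>R\<rceil> \<le> k" "\<nu> \<in> cball 0 R" for k \<nu>
  proof -
    define x where "x = t / 2"
    have split: "x powr (2 * of_nat k + \<nu>) = x ^ (2 * k) * x powr \<nu>"
      unfolding x_def using assms powr_nat'[of "t / 2" "2 * k"] by (simp add: powr_add)
    have sq: "norm x ^ (k * 2) = (norm x ^ 2) ^ k"
      by (subst mult.commute) (rule power_mult)
    have "norm (Bessel_J_term t k \<nu>) =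
        norm (rGamma (of_nat k + \<nu> + 1)) * norm (x powr \<nu>)
          * (inverse (fact k) * (norm x ^ 2) ^ k)"
      unfolding Bessel_J_term_def x_def[symmetric] split
      by (simp add: norm_mult norm_divide norm_power sq field_simps)
    also have "\<dots> \<le> h k"
      unfolding h_def x_def using M C that by (intro mult_right_mono mult_mono) auto
    finally show ?thesis .
  qed
  ultimately show thesis using that by blast
qed

lemma Bessel_J_term_summable:
  assumes "t \<noteq> 0"
  shows "summable (\<lambda>k. Bessel_J_term t k \<nu>)"
proof -
  obtain h where h: "summable h"
    "\<And>k \<mu>. nat \<lceil>norm \<nu>\<rceil> \<le> k \<Longrightarrow> \<mu> \<in> cball 0 (norm \<nu>) \<Longrightarrow> norm (Bessel_J_term t k \<mu>) \<le> h k"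
    using Bessel_J_term_dominated[OF assms, of "norm \<nu>"] by metis
  show ?thesis
    by (rule summable_comparison_test'[OF h(1), of "nat \<lceil>norm \<nu>\<rceil>"]) (use h(2) in auto)
qed

lemma Bessel_J_holomorphic:
  assumes "t \<noteq> 0"
  shows "(\<lambda>\<nu>. Bessel_J \<nu> t) holomorphic_on A"
proof -
  have "(\<lambda>\<nu>. \<Sum>k. Bessel_J_term t k \<nu>) holomorphic_on UNIV"
  proof (rule holomorphic_uniform_sequence[where f = "\<lambda>n \<nu>. \<Sum>k<n. Bessel_J_term t k \<nu>"])
    show "(\<lambda>\<nu>. \<Sum>k<n. Bessel_J_term t k \<nu>) holomorphic_on UNIV" for n
      by (intro holomorphic_intros Bessel_J_term_holomorphic assms)
    fix x :: complex
    define R where "R = norm x + 1"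
    obtain h where h: "summable h"
      "\<And>k \<mu>. nat \<lceil>R\<rceil> \<le> k \<Longrightarrow> \<mu> \<in> cball 0 R \<Longrightarrow> norm (Bessel_J_term t k \<mu>) \<le> h k"
      using Bessel_J_term_dominated[OF assms, of R] by metis
    have sub: "cball x 1 \<subseteq> cball 0 R"
      unfolding R_def by (simp add: cball_subset_cball_iff)
    have "uniform_limit (cball x 1) (\<lambda>n \<nu>. \<Sum>k<n. Bessel_J_term t k \<nu>)
            (\<lambda>\<nu>. \<Sum>k. Bessel_J_term t k \<nu>) sequentially"
      \<comment> \<open>The majorant is available only from index
        \<open>nat \<lceil>R\<rceil>\<close> on, hence the eventual form of the M-test.\<close>
      by (rule Weierstrass_m_test_ev[OF _ h(1)])
         (use h(2) sub in \<open>auto simp: eventually_sequentially intro!: exI[of _ "nat \<lceil>R\<rceil>"]\<close>)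
    then show "\<exists>d>0. cball x d \<subseteq> UNIV \<and>
        uniform_limit (cball x d) (\<lambda>n \<nu>. \<Sum>k<n. Bessel_J_term t k \<nu>)
          (\<lambda>\<nu>. \<Sum>k. Bessel_J_term t k \<nu>) sequentially"
      by (intro exI[of _ 1]) auto
  qed auto
  then show ?thesis
    unfolding Bessel_J_eq_suminf by (rule holomorphic_on_subset) auto
qed

section \<open>Integer orders\<close>

text \<open>At order -n the first n terms vanish, because \<open>rGamma\<close> is evaluated at
  nonpositive integers. Shifting the index by n turns the rest into the series at order n: the
  factorials of k and k + n trade places and the sign (-1)^n comes out.\<close>

lemma Bessel_J_minus_of_nat:
  assumes "t \<noteq> 0"
  shows "Bessel_J (- of_nat n) t = (-1) ^ n * Bessel_J (of_nat n) t"
proof -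
  have shift: "Bessel_J_term t (k + n) (- of_nat n) = (-1) ^ n * Bessel_J_term t k (of_nat n)" for k
  proof -
    have rG: "rGamma (1 + of_nat j :: complex) = 1 / fact j" for j
      by (simp add: rGamma_inverse_Gamma Gamma_fact divide_inverse)
    have e: "2 * of_nat (k + n) + - of_nat n = (2 * of_nat k + of_nat n :: complex)"
      by simp
    have g1: "rGamma (of_nat (k + n) + - of_nat n + 1 :: complex) = 1 / fact k"
      using rG[of k] by (simp add: add_ac)
    have g2: "rGamma (of_nat k + of_nat n + 1 :: complex) = 1 / fact (k + n)"
      using rG[of "k + n"] by (simp add: add_ac)
    show ?thesis
      unfolding Bessel_J_term_def e g1 g2 by (simp add: power_add mult_ac)
  qed
  have zero: "Bessel_J_term t k (- of_nat n) = 0" if "k < n" for k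
  proof -
    have "of_nat k + - of_nat n + 1 = - (of_nat (n - Suc k) :: complex)"
      using that by (simp add: of_nat_diff)
    then show ?thesis
      unfolding Bessel_J_term_def by (simp add: rGamma_eq_zero_iff)
  qed
  have "Bessel_J (- of_nat n) t
      = (\<Sum>k. Bessel_J_term t (k + n) (- of_nat n)) + (\<Sum>k<n. Bessel_J_term t k (- of_nat n))"
    unfolding Bessel_J_eq_suminf
    by (rule suminf_split_initial_segment[OF Bessel_J_term_summable[OF assms]])
  also have "\<dots> = (\<Sum>k. (-1) ^ n * Bessel_J_term t k (of_nat n))"
    unfolding shift by (simp add: zero)
  also have "\<dots> = (-1) ^ n * Bessel_J (of_nat n) t"
    unfolding Bessel_J_eq_suminf by (rule suminf_mult[OF Bessel_J_term_summable[OF assms]])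
  finally show ?thesis .
qed

lemma sin_pi_times_eq_0_iff: "sin (of_real pi * z) = 0 \<longleftrightarrow> z \<in> \<int>" for z :: complex
proof -
  have "sin (of_real pi * z) = 0 \<longleftrightarrow> (\<exists>n::int. z = of_int n)"
    unfolding sin_eq_0 by (auto simp: field_simps)
  then show ?thesis by (auto elim: Ints_cases)
qed

lemma cos_pi_times_of_nat: "cos (of_real pi * of_nat n :: complex) = (-1) ^ n"
  using cos_npi2[of n] cos_of_real[of "pi * real n"] by simp

lemma sin_pi_times_of_nat: "sin (of_real pi * of_nat n :: complex) = 0"
  by (simp add: sin_pi_times_eq_0_iff)

lemma Ints_cases_nat:
  assumes "z \<in> \<int>"
  obtains n where "z = of_nat n" | n where "z = - of_nat n"
proof -
  obtain k where k: "z = of_int k"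
    using assms by (rule Ints_cases)
  show thesis
    using k that by (cases k rule: int_cases2) auto
qed

section \<open>Holomorphy of Y in the order, including the integers\<close>

definition Bessel_Y_numer :: "complex \<Rightarrow> complex \<Rightarrow> complex" where
  "Bessel_Y_numer t \<nu> = Bessel_J \<nu> t * cos (of_real pi * \<nu>) - Bessel_J (- \<nu>) t"

lemma Bessel_Y_numer_holomorphic:
  assumes "t \<noteq> 0"
  shows "Bessel_Y_numer t holomorphic_on A"
proof -
  have "(\<lambda>\<nu>. Bessel_J (- \<nu>) t) holomorphic_on A"
    using holomorphic_on_compose[OF _ Bessel_J_holomorphic[OF assms], of uminus A]
    by (simp add: o_def holomorphic_on_minus)
  then show ?thesis
    unfolding Bessel_Y_numer_def
    by (intro holomorphic_intros Bessel_J_holomorphic assms)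
qed

text \<open>At the order n or -n the cosine is (-1)^n, which matches the sign relating J_n and
  J_{-n}.\<close>

lemma Bessel_Y_numer_Ints:
  assumes "t \<noteq> 0" "\<nu> \<in> \<int>"
  shows "Bessel_Y_numer t \<nu> = 0"
  using assms(2)
  by (cases rule: Ints_cases_nat)
     (simp_all add: Bessel_Y_numer_def cos_pi_times_of_nat Bessel_J_minus_of_nat[OF assms(1)]
        flip: power_add mult_2)

lemma Bessel_Y_not_Ints:
  "\<nu> \<notin> \<int> \<Longrightarrow> Bessel_Y \<nu> t = Bessel_Y_numer t \<nu> / sin (of_real pi * \<nu>)"
  by (simp add: Bessel_Y_def Bessel_Y_numer_def)

text \<open>The integers other than z form a closed set, and \<open>at z\<close> ignores z itself,
  so z may be an integer. Near any point the quotient formula for Y is thus available.\<close>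

lemma eventually_not_Ints: "eventually (\<lambda>w. w \<notin> \<int>) (at z)" for z :: complex
proof -
  have "closed (\<int> - {z} :: complex set)"
    by (rule closed_subset_Ints) auto
  from open_Compl[OF this] have "eventually (\<lambda>w. w \<in> - (\<int> - {z})) (nhds z)"
    by (rule eventually_nhds_in_open) simp
  then show ?thesis
    unfolding eventually_at_filter by eventually_elim auto
qed

text \<open>\<open>Lim\<close> is a definite description and says nothing until a limit is known to
  exist. L'Hopital's rule supplies one: numerator and sine both vanish at z, while the sine has
  derivative \<pi> cos \<pi>z, which is nonzero.\<close>

lemma Bessel_Y_continuous_at_Ints:
  assumes "t \<noteq> 0" "z \<in> \<int>"
  shows "((\<lambda>\<nu>. Bessel_Y \<nu> t) \<longlongrightarrow> Bessel_Y z t) (at z)"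
proof -
  let ?q = "\<lambda>\<mu>. Bessel_Y_numer t \<mu> / sin (of_real pi * \<mu>)"
  have "cos (of_real pi * z) \<noteq> 0"
    using assms(2) sin_cos_squared_add[of "of_real pi * z"]
    by (auto simp: sin_pi_times_eq_0_iff[symmetric])
  moreover have "(Bessel_Y_numer t has_field_derivative deriv (Bessel_Y_numer t) z) (at z)"
    using Bessel_Y_numer_holomorphic[OF assms(1), of UNIV] by (simp add: holomorphic_derivI)
  moreover have "((\<lambda>w. sin (of_real pi * w)) has_field_derivative
      of_real pi * cos (of_real pi * z)) (at z)"
    by (auto intro!: derivative_eq_intros)
  ultimately have lim: "(?q \<longlongrightarrow> deriv (Bessel_Y_numer t) z / (of_real pi * cos (of_real pi * z))) (at z)"
    using assms Bessel_Y_numer_Ints sin_pi_times_eq_0_iff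
    by (intro lhopital_complex_simple) auto
  moreover have "Bessel_Y z t = Lim (at z) ?q"
    using assms(2) by (simp add: Bessel_Y_def Bessel_Y_numer_def)
  ultimately have "(?q \<longlongrightarrow> Bessel_Y z t) (at z)"
    using tendsto_Lim[OF _ lim] by simp
  moreover have "eventually (\<lambda>w. ?q w = Bessel_Y w t) (at z)"
    using eventually_not_Ints by eventually_elim (simp add: Bessel_Y_not_Ints)
  ultimately show ?thesis
    using tendsto_cong by fast
qed

lemma Bessel_Y_holomorphic:
  assumes "t \<noteq> 0"
  shows "(\<lambda>\<nu>. Bessel_Y \<nu> t) holomorphic_on A"
proof -
  have hol: "(\<lambda>\<nu>. Bessel_Y \<nu> t) holomorphic_on - \<int>"
  proof (rule holomorphic_transform)
    show "(\<lambda>\<nu>. Bessel_Y_numer t \<nu> / sin (of_real pi * \<nu>)) holomorphic_on - \<int>"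
      by (intro holomorphic_intros Bessel_Y_numer_holomorphic assms)
         (auto simp: sin_pi_times_eq_0_iff)
  qed (simp add: Bessel_Y_not_Ints)
  have op: "open (- \<int> :: complex set)"
    by (simp add: open_Compl)
  have "(\<lambda>\<nu>. Bessel_Y \<nu> t) field_differentiable at z" for z
  proof (cases "z \<in> \<int>")
    case False
    then show ?thesis
      using hol op holomorphic_on_imp_differentiable_at by blast
  next
    case True
    \<comment> \<open>An open neighbourhood of z with no other integer in it: Y is continuous on
      \<open>S\<close> and holomorphic off z, so the singularity at z is removable.\<close>
    define S where "S = - (\<int> - {z})"
    have open_S: "open S"
      unfolding S_def by (intro open_Compl closed_subset_Ints) auto
    have "continuous (at x) (\<lambda>\<nu>. Bessel_Y \<nu> t)" if "x \<in> S" for x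
    proof (cases "x = z")
      case True
      then show ?thesis
        using Bessel_Y_continuous_at_Ints[OF assms \<open>z \<in> \<int>\<close>] by (simp add: isCont_def)
    next
      case False
      then show ?thesis
        using that[unfolded S_def] hol op holomorphic_on_imp_differentiable_at
          field_differentiable_imp_continuous_at by blast
    qed
    then have "continuous_on S (\<lambda>\<nu>. Bessel_Y \<nu> t)"
      by (simp add: continuous_at_imp_continuous_on)
    moreover have "S - {z} = - \<int>" using True by (auto simp: S_def)
    then have "(\<lambda>\<nu>. Bessel_Y \<nu> t) holomorphic_on S - {z}"
      using hol by simp
    ultimately have "(\<lambda>\<nu>. Bessel_Y \<nu> t) holomorphic_on S"
      by (rule no_isolated_singularity[OF _ _ open_S]) simp
    then show ?thesis
      by (rule holomorphic_on_imp_differentiable_at[OF _ open_S]) (simp add: S_def)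
  qed
  then show ?thesis
    by (simp add: holomorphic_on_def field_differentiable_at_within)
qed

section \<open>The reflection formula\<close>

lemma Bessel_Y_minus:
  assumes "t \<noteq> 0"
  shows "Bessel_Y (- \<nu>) t
    = Bessel_J \<nu> t * sin (of_real pi * \<nu>) + Bessel_Y \<nu> t * cos (of_real pi * \<nu>)"
proof -
  let ?L = "\<lambda>\<nu>. Bessel_Y (- \<nu>) t"
  let ?R = "\<lambda>\<nu>. Bessel_J \<nu> t * sin (of_real pi * \<nu>) + Bessel_Y \<nu> t * cos (of_real pi * \<nu>)"
  have eq: "?L w = ?R w" if "w \<notin> \<int>" for w
  proof -
    define s c where "s = sin (of_real pi * w)" and "c = cos (of_real pi * w)"
    have s: "s \<noteq> 0"
      using that by (simp add: s_def sin_pi_times_eq_0_iff)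
    have sc: "s * s + c * c = 1"
      using sin_cos_squared_add[of "of_real pi * w"] by (simp add: s_def c_def power2_eq_square)
    have "- w \<notin> \<int>" using that by simp
    then have "?L w * s = Bessel_J w t - Bessel_J (- w) t * c"
      using s by (simp add: Bessel_Y_not_Ints Bessel_Y_numer_def s_def c_def)
    moreover have "Bessel_Y w t * s = Bessel_J w t * c - Bessel_J (- w) t"
      using that s by (simp add: Bessel_Y_not_Ints Bessel_Y_numer_def s_def c_def)
    \<comment> \<open>Substituting J_{-w} = J_w c - Y_w s into J_w - J_{-w} c gives J_w (1 - c^2) +
      Y_w s c, and 1 - c^2 = s^2.\<close>
    ultimately have "?L w * s = (Bessel_J w t * s + Bessel_Y w t * c) * s"
      using sc by algebra
    then show ?thesis using s by (simp add: s_def c_def)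
  qed
  have "continuous_on UNIV ?L"
    by (rule continuous_on_compose2[OF holomorphic_on_imp_continuous_on[OF Bessel_Y_holomorphic[OF assms]]])
       (auto intro!: continuous_intros)
  then have "(?L \<longlongrightarrow> ?L \<nu>) (at \<nu>)"
    by (simp add: continuous_on_def)
  moreover have "continuous_on UNIV ?R"
    by (intro holomorphic_on_imp_continuous_on holomorphic_intros
          Bessel_J_holomorphic Bessel_Y_holomorphic assms)
  then have "(?R \<longlongrightarrow> ?R \<nu>) (at \<nu>)"
    by (simp add: continuous_on_def)
  moreover have "eventually (\<lambda>w. ?L w = ?R w) (at \<nu>)"
    using eventually_not_Ints by eventually_elim (rule eq)
  ultimately have "(?R \<longlongrightarrow> ?L \<nu>) (at \<nu>)" "(?R \<longlongrightarrow> ?R \<nu>) (at \<nu>)"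
    using tendsto_cong[of ?L ?R] by simp_all
  then show ?thesis
    by (rule tendsto_unique[OF trivial_limit_at])
qed

section \<open>Second derivatives in the order\<close>

text \<open>An equation between functions, so that it can rewrite the inner \<open>deriv\<close> of
  a second derivative.\<close>

lemma deriv_sin_linear: "deriv (\<lambda>w. sin (a * w)) = (\<lambda>w. a * cos (a * w))" for a :: complex
  by (rule ext, rule DERIV_imp_deriv) (auto intro!: derivative_eq_intros)

lemma deriv_cos_linear: "deriv (\<lambda>w. cos (a * w)) = (\<lambda>w. - (a * sin (a * w)))" for a :: complex
  by (rule ext, rule DERIV_imp_deriv) (auto intro!: derivative_eq_intros)

lemma deriv2_sin_linear: "(deriv ^^ 2) (\<lambda>w. sin (a * w)) z = - a\<^sup>2 * sin (a * z)" for a :: complex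
proof -
  have "((\<lambda>w. a * cos (a * w)) has_field_derivative - a\<^sup>2 * sin (a * z)) (at z)"
    by (auto intro!: derivative_eq_intros simp: power2_eq_square)
  then show ?thesis
    by (simp add: numeral_2_eq_2 deriv_sin_linear DERIV_imp_deriv)
qed

lemma deriv2_cos_linear: "(deriv ^^ 2) (\<lambda>w. cos (a * w)) z = - a\<^sup>2 * cos (a * z)" for a :: complex
proof -
  have "((\<lambda>w. - (a * sin (a * w))) has_field_derivative - a\<^sup>2 * cos (a * z)) (at z)"
    by (auto intro!: derivative_eq_intros simp: power2_eq_square)
  then show ?thesis
    by (simp add: numeral_2_eq_2 deriv_cos_linear DERIV_imp_deriv)
qed

lemma deriv2_mult:
  assumes "f holomorphic_on UNIV" "g holomorphic_on UNIV"
  shows "(deriv ^^ 2) (\<lambda>w. f w * g w) z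
    = f z * (deriv ^^ 2) g z + 2 * deriv f z * deriv g z + (deriv ^^ 2) f z * g z"
  using higher_deriv_mult[OF assms, of z 2] by (simp add: numeral_2_eq_2 add_ac)

theorem theorem3p7:
  fixes t :: complex and m :: nat
  assumes "t \<noteq> 0"
  shows "(\<lambda>\<nu>. Bessel_Y \<nu> t) analytic_on {of_nat m, - of_nat m} \<and>
         (\<lambda>\<nu>. Bessel_J \<nu> t) analytic_on {of_nat m} \<and>
         (deriv ^^ 2) (\<lambda>\<nu>. Bessel_Y \<nu> t) (of_nat m)
           + (-1) ^ (m + 1) * (deriv ^^ 2) (\<lambda>\<nu>. Bessel_Y \<nu> t) (- of_nat m)
         = - 2 * of_real pi * deriv (\<lambda>\<nu>. Bessel_J \<nu> t) (of_nat m)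
           + (of_real pi)\<^sup>2 * Bessel_Y (of_nat m) t"
proof -
  let ?Y = "\<lambda>\<nu>. Bessel_Y \<nu> t" and ?J = "\<lambda>\<nu>. Bessel_J \<nu> t"
  let ?s = "\<lambda>\<nu>::complex. sin (of_real pi * \<nu>)" and ?c = "\<lambda>\<nu>::complex. cos (of_real pi * \<nu>)"
  let ?m = "of_nat m :: complex"
  note hol = Bessel_Y_holomorphic[OF assms, of UNIV] Bessel_J_holomorphic[OF assms, of UNIV]
  have hols: "?s holomorphic_on UNIV" "?c holomorphic_on UNIV"
    by (intro holomorphic_intros)+
  have "(deriv ^^ 2) (\<lambda>\<nu>. ?Y (- \<nu>)) ?m = (deriv ^^ 2) ?Y (- ?m)"
    \<comment> \<open>The inner slope -1 enters squared, so no sign appears.\<close>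
    using higher_deriv_compose_linear'[OF hol(1) open_UNIV open_UNIV, of ?m "-1" 0 2] by simp
  also have "(\<lambda>\<nu>. ?Y (- \<nu>)) = (\<lambda>\<nu>. ?J \<nu> * ?s \<nu> + ?Y \<nu> * ?c \<nu>)"
    using Bessel_Y_minus[OF assms] by auto
  also have "(deriv ^^ 2) \<dots> ?m
      = (deriv ^^ 2) (\<lambda>\<nu>. ?J \<nu> * ?s \<nu>) ?m + (deriv ^^ 2) (\<lambda>\<nu>. ?Y \<nu> * ?c \<nu>) ?m"
    by (rule higher_deriv_add[of _ UNIV]) (intro holomorphic_intros hol hols open_UNIV UNIV_I)+
  \<comment> \<open>At m the sine vanishes: the product with J keeps only its cross term, and the
    product with Y loses its cross term.\<close>
  also have "\<dots> = (-1) ^ m *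
      (2 * of_real pi * deriv ?J ?m + (deriv ^^ 2) ?Y ?m - (of_real pi)\<^sup>2 * ?Y ?m)"
    unfolding deriv2_mult[OF hol(2) hols(1)] deriv2_mult[OF hol(1) hols(2)]
      deriv2_sin_linear deriv2_cos_linear deriv_sin_linear deriv_cos_linear
      sin_pi_times_of_nat cos_pi_times_of_nat
    by (simp add: algebra_simps)
  \<comment> \<open>The two powers of -1 combine to an overall minus sign, so adding the second
    derivative of Y at m cancels the one inside the bracket.\<close>
  finally have "(-1) ^ (m + 1) * (deriv ^^ 2) ?Y (- ?m) =
      - (((-1) ^ m * (-1) ^ m) *
         (2 * of_real pi * deriv ?J ?m + (deriv ^^ 2) ?Y ?m - (of_real pi)\<^sup>2 * ?Y ?m))"
    by (simp only: power_add power_one_right mult_minus_right mult_minus_left mult_1_right mult.assoc)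
  also have "(-1) ^ m * (-1) ^ m = (1 :: complex)"
    by (simp flip: power_add mult_2)
  finally have "(deriv ^^ 2) ?Y ?m + (-1) ^ (m + 1) * (deriv ^^ 2) ?Y (- ?m)
      = - 2 * of_real pi * deriv ?J ?m + (of_real pi)\<^sup>2 * ?Y ?m"
    by (simp add: algebra_simps)
  \<comment> \<open>Since \<open>deriv\<close> is total, analyticity is what makes the derivatives
    in the formula genuine.\<close>
  moreover have "?Y analytic_on A" "?J analytic_on A" for A
    using hol analytic_on_holomorphic by blast+
  ultimately show ?thesis by blast
qed

end
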